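(* Let $n\ge1$. There exists an $\alpha\in\Psi$ for which $dS_{n+1}(f_\alpha)$ is a spacelike hypersurface.
   Context: $\mathbb{R}^{n+2}_1$ is $\mathbb{R}^{n+2}$ with metric $\eta=-dx^0\otimes dx^0+dx^1\otimes dx^1+\cdots+dx^{n+1}\otimes dx^{n+1}$. For a smooth function $f:(a,b)\to\mathbb{R}$ on an open interval (possibly unbounded), $dS_{n+1}(f)$ is the hypersurface $\{x\in\mathbb{R}^{n+2}_1 : x^0\in(a,b),\ -(x^0)^2+(x^1)^2+\cdots+(x^{n+1})^2=f(x^0)^2\}$ with the metric induced from $\eta$. $\Psi$ is the set of smooth functions $\alpha:\mathbb{R}\to\mathbb{R}$ with $\alpha(t)>0$ for all $t$ and such that $h(t):=\alpha(t)\sinh t$ has nonzero derivative for all $t$. For $\alpha\in\Psi$, $f_\alpha:=\alpha\circ h^{-1}$ on the open interval $h(\mathbb{R})$. A hypersurface is spacelike if its normal at every point is a timelike vector ($\eta(v,v)<0$); equivalently, the induced metric is Riemannian. *)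

theory Defs
  imports "HOL-Analysis.Analysis"
begin

text \<open>\<open>C\<^sup>k\<close> and smooth maps on an open set of a normed space: continuity of \<open>f\<close> and of all its iterated
  directional derivatives, where the derivative at each stage is the Frechet derivative.\<close>

primrec higher_differentiable_on ::
  "nat \<Rightarrow> 'a::real_normed_vector set \<Rightarrow> ('a \<Rightarrow> 'b::real_normed_vector) \<Rightarrow> bool" where
  "higher_differentiable_on 0 U f \<longleftrightarrow> continuous_on U f"
| "higher_differentiable_on (Suc k) U f \<longleftrightarrow>
     (\<forall>x\<in>U. f differentiable (at x)) \<and>
     (\<forall>v. higher_differentiable_on k U (\<lambda>x. frechet_derivative f (at x) v))"

definition smooth_on :: "'a::real_normed_vector set \<Rightarrow> ('a \<Rightarrow> 'b::real_normed_vector) \<Rightarrow> bool" where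
  "smooth_on U f \<longleftrightarrow> (\<forall>k. higher_differentiable_on k U f)"

text \<open>Minkowski space of dimension \<open>CARD('k) + 1\<close>: the first component of the pair is the time
  coordinate \<open>x\<^sup>0\<close>, the second collects the space coordinates.\<close>

type_synonym 'k minkowski = "real \<times> (real ^ 'k)"

definition eta :: "'k::finite minkowski \<Rightarrow> 'k minkowski \<Rightarrow> real" where
  "eta v w = - (fst v * fst w) + (\<Sum>i\<in>UNIV. (snd v $ i) * (snd w $ i))"

definition timelike :: "'k::finite minkowski \<Rightarrow> bool" where
  "timelike v \<longleftrightarrow> eta v v < 0"

text \<open>Smooth embedded hypersurfaces, as sets that are locally regular zero sets of a smooth
  function.\<close>

definition smooth_hypersurface :: "'k::finite minkowski set \<Rightarrow> bool" where
  "smooth_hypersurface S \<longleftrightarrow>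
     (\<forall>p\<in>S. \<exists>U (F :: 'k minkowski \<Rightarrow> real).
        open U \<and> p \<in> U \<and> smooth_on U F \<and> S \<inter> U = {x \<in> U. F x = 0} \<and>
        (\<forall>x \<in> S \<inter> U. frechet_derivative F (at x) \<noteq> (\<lambda>v. 0)))"

definition tangent_space :: "'k::finite minkowski set \<Rightarrow> 'k minkowski \<Rightarrow> 'k minkowski set" where
  "tangent_space S p =
     {v. \<exists>\<epsilon> > 0. \<exists>\<gamma>. smooth_on {-\<epsilon><..<\<epsilon>} \<gamma> \<and> \<gamma> ` {-\<epsilon><..<\<epsilon>} \<subseteq> S \<and> \<gamma> 0 = p \<and>
          (\<gamma> has_vector_derivative v) (at 0)}"

text \<open>Normality is with respect to \<open>eta\<close>, not the Euclidean inner product. At a point of a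
  hypersurface the normal vectors form a line without its origin, so quantifying over all of
  them below is the same as speaking of the normal.\<close>

definition normal_vector :: "'k::finite minkowski set \<Rightarrow> 'k minkowski \<Rightarrow> 'k minkowski \<Rightarrow> bool" where
  "normal_vector S p \<nu> \<longleftrightarrow> \<nu> \<noteq> 0 \<and> (\<forall>v \<in> tangent_space S p. eta \<nu> v = 0)"

definition spacelike_hypersurface :: "'k::finite minkowski set \<Rightarrow> bool" where
  "spacelike_hypersurface S \<longleftrightarrow>
     smooth_hypersurface S \<and> (\<forall>p\<in>S. \<forall>\<nu>. normal_vector S p \<nu> \<longrightarrow> timelike \<nu>)"

text \<open>Here \<open>I\<close> stands for the open interval on which \<open>f\<close> is given; values of \<open>f\<close> outside \<open>I\<close> play
  no role.\<close>

definition dS :: "real set \<Rightarrow> (real \<Rightarrow> real) \<Rightarrow> 'k::finite minkowski set" where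
  "dS I f = {x. fst x \<in> I \<and> - (fst x)\<^sup>2 + (\<Sum>i\<in>UNIV. (snd x $ i)\<^sup>2) = (f (fst x))\<^sup>2}"

definition h_of :: "(real \<Rightarrow> real) \<Rightarrow> real \<Rightarrow> real" where
  "h_of \<alpha> t = \<alpha> t * sinh t"

definition Psi :: "(real \<Rightarrow> real) set" where
  "Psi = {\<alpha>. smooth_on UNIV \<alpha> \<and> (\<forall>t. \<alpha> t > 0) \<and> (\<forall>t. deriv (h_of \<alpha>) t \<noteq> 0)}"

text \<open>For \<open>\<alpha> \<in> Psi\<close> the function \<open>h_of \<alpha>\<close> is injective, so \<open>inv\<close> is its genuine inverse on the open
  interval \<open>range (h_of \<alpha>)\<close>; off that interval \<open>f_of \<alpha>\<close> is junk.\<close>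

definition f_of :: "(real \<Rightarrow> real) \<Rightarrow> real \<Rightarrow> real" where
  "f_of \<alpha> = \<alpha> \<circ> inv (h_of \<alpha>)"

end

theory Submission
  imports Defs
begin

text \<open>
  Write \<open>r\<close> for the Euclidean length of the space part of a point. The hypersurface defined by
  \<open>\<alpha>\<close> is obtained by rotating the profile curve \<open>x\<^sup>0 = \<alpha> t * sinh t\<close>, \<open>r = \<alpha> t * cosh t\<close>, and it
  is spacelike as soon as this curve has slope \<open>\<bar>dr / dx\<^sup>0\<bar> > 1\<close>: the tangent vectors to the
  spheres \<open>x\<^sup>0 = const\<close> are spacelike anyway, and they force a normal vector to lie in the plane
  of the time axis and the radial direction, where it is timelike because it is orthogonal to the
  spacelike velocity of the profile curve.

  The choice of \<open>\<alpha>\<close> is easiest to find in the null coordinates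
  \<open>p = r + x\<^sup>0 = \<alpha> t * exp t\<close> and \<open>q = r - x\<^sup>0 = \<alpha> t * exp (- t)\<close>. Here the velocity is spacelike
  iff \<open>dp * dq > 0\<close>, the quotient \<open>p / q = exp (2 * t)\<close> must run through all positive numbers \<open>s\<close>,
  and \<open>x\<^sup>0 = (p - q) / 2\<close> must have nonzero derivative. With \<open>p = s * q\<close>, the choice \<open>q = 1 + s\<close>
  satisfies all this and gives
  \<open>\<alpha> t = exp t + exp (3 * t)\<close>, \<open>x\<^sup>0 = (s\<^sup>2 - 1) / 2\<close> and \<open>r = (1 + s)\<^sup>2 / 2\<close>. The slope is
  \<open>(1 + s) / s > 1\<close>. Note that \<open>\<alpha> = 1\<close>, which is ordinary de Sitter space, has slope
  \<open>tanh t\<close>, below \<open>1\<close>.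

  Eliminating \<open>s\<close> gives \<open>(r - x\<^sup>0)\<^sup>2 = 2 * r\<close>, and multiplying this equation by its image under
  \<open>r \<mapsto> - r\<close> makes it polynomial in the coordinates; that is the defining function used for
  regularity. Every function that occurs is smooth on the whole space, so smoothness reduces to
  exhibiting families of functions closed under directional derivatives.
\<close>

section \<open>Smoothness of elementary functions\<close>

text \<open>A coinduction principle: membership in a family of differentiable functions that is closed
  under directional derivatives can be iterated through all orders.\<close>

lemma smooth_on_coinduct:
  assumes "P f"
    and step: "\<And>f. P f \<Longrightarrow> \<exists>f'. (\<forall>x. (f has_derivative f' x) (at x)) \<and> (\<forall>v. P (\<lambda>x. f' x v))"
  shows "smooth_on U f"
proof -
  have "higher_differentiable_on k U f" for k
    using \<open>P f\<close>
  proof (induction k arbitrary: f)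
    case 0
    then obtain f' where "\<forall>x. (f has_derivative f' x) (at x)"
      using step by blast
    then show ?case
      by (auto intro!: continuous_at_imp_continuous_on dest: has_derivative_continuous)
  next
    case (Suc k)
    then obtain f' where f': "\<And>x. (f has_derivative f' x) (at x)" "\<And>v. P (\<lambda>x. f' x v)"
      using step by blast
    then have "frechet_derivative f (at x) = f' x" for x
      using frechet_derivative_at by metis
    with f' Suc.IH show ?case
      by (auto simp: differentiable_def)
  qed
  then show ?thesis
    by (simp add: smooth_on_def)
qed

lemma has_derivative_real_polynomial_function:
  fixes f :: "'a::real_normed_vector \<Rightarrow> real"
  assumes "real_polynomial_function f"
  shows "\<exists>f'. (\<forall>x. (f has_derivative f' x) (at x)) \<and> (\<forall>v. real_polynomial_function (\<lambda>x. f' x v))"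
  using assms
proof (induction f rule: real_polynomial_function.induct)
  case (linear f)
  then show ?case
    by (intro exI[of _ "\<lambda>x. f"])
      (auto intro: bounded_linear_imp_has_derivative real_polynomial_function.intros)
next
  case (const c)
  show ?case
    by (intro exI[of _ "\<lambda>x v. 0"]) (auto intro: real_polynomial_function.intros)
next
  case (add f g)
  then obtain f' g' where "\<forall>x. (f has_derivative f' x) (at x)" "\<forall>x. (g has_derivative g' x) (at x)"
    "\<forall>v. real_polynomial_function (\<lambda>x. f' x v)" "\<forall>v. real_polynomial_function (\<lambda>x. g' x v)"
    by blast
  then show ?case
    by (intro exI[of _ "\<lambda>x v. f' x v + g' x v"])
      (auto intro: has_derivative_add real_polynomial_function.intros)
next
  case (mult f g)
  then obtain f' g' where "\<forall>x. (f has_derivative f' x) (at x)" "\<forall>x. (g has_derivative g' x) (at x)"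
    "\<forall>v. real_polynomial_function (\<lambda>x. f' x v)" "\<forall>v. real_polynomial_function (\<lambda>x. g' x v)"
    by blast
  with mult.hyps show ?case
    by (intro exI[of _ "\<lambda>x v. f x * g' x v + f' x v * g x"])
      (auto intro!: has_derivative_mult real_polynomial_function.intros(3,4))
qed

lemma smooth_on_real_polynomial_function:
  fixes f :: "'a::real_normed_vector \<Rightarrow> real"
  assumes "real_polynomial_function f"
  shows "smooth_on U f"
  using assms by (rule smooth_on_coinduct) (rule has_derivative_real_polynomial_function)

lemma smooth_on_quadratic_curve:
  fixes a b c :: "'a::real_normed_vector"
  shows "smooth_on U (\<lambda>t::real. a + t *\<^sub>R b + t\<^sup>2 *\<^sub>R c)"
proof (rule smooth_on_coinduct[where P = "\<lambda>f. \<exists>a b c. f = (\<lambda>t::real. a + t *\<^sub>R b + t\<^sup>2 *\<^sub>R c)"])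
  fix f :: "real \<Rightarrow> 'a"
  assume "\<exists>a b c. f = (\<lambda>t. a + t *\<^sub>R b + t\<^sup>2 *\<^sub>R c)"
  then obtain a b c where f: "f = (\<lambda>t. a + t *\<^sub>R b + t\<^sup>2 *\<^sub>R c)"
    by blast
  have "(f has_derivative (\<lambda>v. v *\<^sub>R b + t *\<^sub>R ((2 * v) *\<^sub>R c) + t\<^sup>2 *\<^sub>R 0)) (at t)" for t
    unfolding f by (auto intro!: derivative_eq_intros simp: algebra_simps)
  then show "\<exists>f'. (\<forall>t. (f has_derivative f' t) (at t)) \<and>
      (\<forall>v. \<exists>a b c. (\<lambda>t. f' t v) = (\<lambda>t. a + t *\<^sub>R b + t\<^sup>2 *\<^sub>R c))"
    by (intro exI[of _ "\<lambda>t v. v *\<^sub>R b + t *\<^sub>R ((2 * v) *\<^sub>R c) + t\<^sup>2 *\<^sub>R 0"]) blast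
qed blast

lemma smooth_on_elliptic_curve:
  fixes a b c :: "'a::real_normed_vector"
  shows "smooth_on U (\<lambda>t::real. a + cos t *\<^sub>R b + sin t *\<^sub>R c)"
proof (rule smooth_on_coinduct[where P = "\<lambda>f. \<exists>a b c. f = (\<lambda>t::real. a + cos t *\<^sub>R b + sin t *\<^sub>R c)"])
  fix f :: "real \<Rightarrow> 'a"
  assume "\<exists>a b c. f = (\<lambda>t. a + cos t *\<^sub>R b + sin t *\<^sub>R c)"
  then obtain a b c where f: "f = (\<lambda>t. a + cos t *\<^sub>R b + sin t *\<^sub>R c)"
    by blast
  have "(f has_derivative (\<lambda>v. 0 + cos t *\<^sub>R (v *\<^sub>R c) + sin t *\<^sub>R (- v *\<^sub>R b))) (at t)" for t
    unfolding f by (auto intro!: derivative_eq_intros simp: algebra_simps)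
  then show "\<exists>f'. (\<forall>t. (f has_derivative f' t) (at t)) \<and>
      (\<forall>v. \<exists>a b c. (\<lambda>t. f' t v) = (\<lambda>t. a + cos t *\<^sub>R b + sin t *\<^sub>R c))"
    by (intro exI[of _ "\<lambda>t v. 0 + cos t *\<^sub>R (v *\<^sub>R c) + sin t *\<^sub>R (- v *\<^sub>R b)"]) blast
qed blast

lemma smooth_on_exp_combination:
  fixes a b k l :: real
  shows "smooth_on U (\<lambda>t. a * exp (k * t) + b * exp (l * t))"
proof (rule smooth_on_coinduct[where P = "\<lambda>f. \<exists>a b. f = (\<lambda>t. a * exp (k * t) + b * exp (l * t))"])
  fix f :: "real \<Rightarrow> real"
  assume "\<exists>a b. f = (\<lambda>t. a * exp (k * t) + b * exp (l * t))"
  then obtain a b where f: "f = (\<lambda>t. a * exp (k * t) + b * exp (l * t))"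
    by blast
  have "(f has_derivative (\<lambda>v. (a * k * v) * exp (k * t) + (b * l * v) * exp (l * t))) (at t)" for t
    unfolding f by (auto intro!: derivative_eq_intros simp: algebra_simps)
  then show "\<exists>f'. (\<forall>t. (f has_derivative f' t) (at t)) \<and>
      (\<forall>v. \<exists>a b. (\<lambda>t. f' t v) = (\<lambda>t. a * exp (k * t) + b * exp (l * t)))"
    by (intro exI[of _ "\<lambda>t v. (a * k * v) * exp (k * t) + (b * l * v) * exp (l * t)"]) blast
qed blast

section \<open>The hypersurface and its profile curve\<close>

definition witness :: "real \<Rightarrow> real" where
  "witness t = exp t + exp (3 * t)"

text \<open>The rotation of the profile curve \<open>x\<^sup>0 = (s\<^sup>2 - 1) / 2\<close>, \<open>r = (1 + s)\<^sup>2 / 2\<close> for \<open>s > 0\<close>.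
  The parameter is \<open>s = exp (2 * t)\<close> rather than \<open>t\<close>, so that the curve is polynomial.\<close>

definition rotated_profile :: "'k::finite minkowski set" where
  "rotated_profile = {x. \<exists>s>0. fst x = (s\<^sup>2 - 1) / 2 \<and> norm (snd x) = (1 + s)\<^sup>2 / 2}"

lemma eta_eq_inner: "eta v w = - (fst v * fst w) + snd v \<bullet> snd w"
  by (simp add: eta_def inner_vec_def)

lemma h_of_witness: "h_of witness t = (exp (4 * t) - 1) / 2"
proof -
  have "exp (3 * t) = exp t ^ 3" "exp (4 * t) = exp t ^ 4"
    by (simp_all flip: exp_of_nat_mult)
  then show ?thesis
    by (simp add: h_of_def witness_def sinh_field_def exp_minus field_simps power_numeral_reduce)
qed

lemma witness_in_Psi: "witness \<in> Psi"
proof -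
  have "smooth_on UNIV witness"
    using smooth_on_exp_combination[of UNIV 1 1 1 3] by (simp add: witness_def[abs_def])
  moreover have "(h_of witness has_field_derivative 2 * exp (4 * t)) (at t)" for t
    unfolding h_of_witness[abs_def] by (auto intro!: derivative_eq_intros)
  then have "deriv (h_of witness) t = 2 * exp (4 * t)" for t
    by (rule DERIV_imp_deriv)
  ultimately show ?thesis
    by (simp add: Psi_def witness_def add_pos_pos)
qed

lemma dS_witness:
  "dS (range (h_of witness)) (f_of witness) = (rotated_profile :: 'k::finite minkowski set)"
proof -
  have "inj (h_of witness)"
    by (auto simp: inj_def h_of_witness)
  then have f_of: "f_of witness (h_of witness t) = witness t" for t
    by (simp add: f_of_def)
  have point: "- (h_of witness t)\<^sup>2 + (\<Sum>i\<in>UNIV. (y $ i)\<^sup>2) = (witness t)\<^sup>2 \<longleftrightarrow>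
      norm y = (1 + exp (2 * t))\<^sup>2 / 2" for t and y :: "real ^ 'k"
  proof -
    have exps: "exp (2 * t) = exp t ^ 2" "exp (3 * t) = exp t ^ 3" "exp (4 * t) = exp t ^ 4"
      by (simp_all flip: exp_of_nat_mult)
    have "(\<Sum>i\<in>UNIV. (y $ i)\<^sup>2) = (norm y)\<^sup>2"
      by (simp add: power2_norm_eq_inner inner_vec_def flip: power2_eq_square)
    moreover have "(h_of witness t)\<^sup>2 + (witness t)\<^sup>2 = ((1 + exp (2 * t))\<^sup>2 / 2)\<^sup>2"
      unfolding h_of_witness witness_def exps by (simp add: field_simps power_numeral_reduce)
    ultimately have "- (h_of witness t)\<^sup>2 + (\<Sum>i\<in>UNIV. (y $ i)\<^sup>2) = (witness t)\<^sup>2 \<longleftrightarrow>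
        (norm y)\<^sup>2 = ((1 + exp (2 * t))\<^sup>2 / 2)\<^sup>2"
      by linarith
    then show ?thesis
      by (simp add: power2_eq_iff_nonneg)
  qed
  have time: "h_of witness t = ((exp (2 * t))\<^sup>2 - 1) / 2" for t
    by (simp add: h_of_witness flip: exp_of_nat_mult)
  have param: "(\<exists>s>0. Q s) \<longleftrightarrow> (\<exists>t. Q (exp (2 * t)))" for Q :: "real \<Rightarrow> bool"
  proof
    assume "\<exists>s>0. Q s"
    then obtain s where "s > 0" "Q s" by blast
    then have "Q (exp (2 * (ln s / 2)))" by simp
    then show "\<exists>t. Q (exp (2 * t))" ..
  qed (use exp_gt_zero in blast)
  have "x \<in> dS (range (h_of witness)) (f_of witness) \<longleftrightarrow>
      (\<exists>t. fst x = h_of witness t \<and> norm (snd x) = (1 + exp (2 * t))\<^sup>2 / 2)"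
    for x :: "'k minkowski"
    using f_of point by (fastforce simp: dS_def)
  then show ?thesis
    by (auto simp: rotated_profile_def param time)
qed

section \<open>Regularity\<close>

text \<open>With \<open>r = norm (snd x)\<close> and \<open>u = fst x\<close> this is
  \<open>(r\<^sup>2 + u\<^sup>2 - 2 * r * (1 + u)) * (r\<^sup>2 + u\<^sup>2 + 2 * r * (1 + u))\<close>, whose first factor is
  \<open>(r - u)\<^sup>2 - 2 * r\<close>. The product contains only even powers of \<open>r\<close>.\<close>

definition defining_function :: "'k::finite minkowski \<Rightarrow> real" where
  "defining_function x =
     (snd x \<bullet> snd x + (fst x)\<^sup>2)\<^sup>2 - 4 * (snd x \<bullet> snd x) * (1 + fst x)\<^sup>2"

text \<open>The zeros of the defining function in \<open>u > - 1 / 2\<close> are \<open>r = 1 + u \<plusminus> s\<close> with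
  \<open>s = sqrt (1 + 2 * u)\<close>; requiring \<open>r > 1 + u\<close> selects the branch of the profile curve.\<close>

definition profile_region :: "'k::finite minkowski set" where
  "profile_region = {x. fst x > - 1 / 2 \<and> norm (snd x) > 1 + fst x}"

lemma open_profile_region: "open profile_region"
  unfolding profile_region_def by (intro open_Collect_conj open_Collect_less continuous_intros)

lemma smooth_on_defining_function: "smooth_on U (defining_function :: 'k::finite minkowski \<Rightarrow> real)"
proof (rule smooth_on_real_polynomial_function)
  have "real_polynomial_function (\<lambda>x :: 'k minkowski. fst x)"
    by (intro real_polynomial_function.intros(1) bounded_linear_fst)
  moreover have "real_polynomial_function (\<lambda>x :: 'k minkowski. snd x $ i)" for i
    by (intro real_polynomial_function.intros(1) bounded_linear_compose[OF bounded_linear_vec_nth bounded_linear_snd])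
  then have "real_polynomial_function (\<lambda>x :: 'k minkowski. snd x \<bullet> snd x)"
    by (auto simp: inner_vec_def intro!: real_polynomial_function_sum real_polynomial_function.intros(4))
  ultimately show "real_polynomial_function (defining_function :: 'k minkowski \<Rightarrow> real)"
    unfolding defining_function_def[abs_def]
    by (intro real_polynomial_function_diff real_polynomial_function_power real_polynomial_function.intros(2-4))
qed

text \<open>The second factor of the defining function is positive on the region, and completing the square
  in \<open>r\<close> brings the first into the form used here.\<close>

lemma defining_function_eq_0_iff:
  assumes "x \<in> profile_region"
  shows "defining_function x = 0 \<longleftrightarrow> (norm (snd x) - (1 + fst x))\<^sup>2 = 1 + 2 * fst x"
proof -
  define u r where "u = fst x" and "r = norm (snd x)"
  have ur: "u > - 1 / 2" "r > 1 + u"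
    using assms by (auto simp: profile_region_def u_def r_def)
  have "defining_function x = (r\<^sup>2 + u\<^sup>2)\<^sup>2 - 4 * r\<^sup>2 * (1 + u)\<^sup>2"
    by (simp add: defining_function_def u_def r_def power2_norm_eq_inner)
  also have "\<dots> = (r\<^sup>2 + u\<^sup>2 + 2 * r * (1 + u)) * ((r - (1 + u))\<^sup>2 - (1 + 2 * u))"
    by algebra
  finally have "defining_function x =
      (r\<^sup>2 + u\<^sup>2 + 2 * r * (1 + u)) * ((r - (1 + u))\<^sup>2 - (1 + 2 * u))" .
  moreover have "r\<^sup>2 + u\<^sup>2 + 2 * r * (1 + u) > 0"
    using ur by (simp add: add_nonneg_pos)
  ultimately show ?thesis
    unfolding u_def r_def by simp
qed

lemma rotated_profile_subset_region: "rotated_profile \<subseteq> profile_region"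
proof
  fix x :: "'k::finite minkowski"
  assume "x \<in> rotated_profile"
  then obtain s where s: "s > 0" "fst x = (s\<^sup>2 - 1) / 2" "norm (snd x) = (1 + s)\<^sup>2 / 2"
    by (auto simp: rotated_profile_def)
  then have "norm (snd x) = 1 + fst x + s"
    by (simp add: power2_eq_square field_simps)
  moreover have "fst x > - 1 / 2"
  proof -
    have "- 1 < s\<^sup>2 - 1"
      using s(1) by simp
    then show ?thesis
      unfolding s(2) by (rule divide_strict_right_mono) simp
  qed
  ultimately show "x \<in> profile_region"
    using s(1) by (simp add: profile_region_def)
qed

lemma rotated_profile_eq_zero_set:
  "rotated_profile = {x \<in> profile_region. defining_function x = 0}"
proof (intro set_eqI iffI)
  fix x :: "'k::finite minkowski"
  assume x: "x \<in> rotated_profile"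
  then obtain s where s: "s > 0" "fst x = (s\<^sup>2 - 1) / 2" "norm (snd x) = (1 + s)\<^sup>2 / 2"
    by (auto simp: rotated_profile_def)
  then have "norm (snd x) - (1 + fst x) = s"
    by (simp add: power2_eq_square field_simps)
  with s x show "x \<in> {x \<in> profile_region. defining_function x = 0}"
    using rotated_profile_subset_region by (auto simp: defining_function_eq_0_iff)
next
  fix x :: "'k::finite minkowski"
  assume "x \<in> {x \<in> profile_region. defining_function x = 0}"
  then have x: "x \<in> profile_region" "(norm (snd x) - (1 + fst x))\<^sup>2 = 1 + 2 * fst x"
    using defining_function_eq_0_iff by blast+
  define s where "s = norm (snd x) - (1 + fst x)"
  have "s > 0" "s\<^sup>2 = 1 + 2 * fst x"
    using x by (auto simp: s_def profile_region_def)
  moreover from this have "norm (snd x) = (1 + s)\<^sup>2 / 2"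
    by (simp add: power2_sum) (simp add: s_def)
  ultimately show "x \<in> rotated_profile"
    unfolding rotated_profile_def by (intro CollectI exI[of _ s]) auto
qed

text \<open>The gradient is tested in the radial direction: with \<open>r\<^sup>2 + u\<^sup>2 = 2 * r * (1 + u)\<close>, the
  derivative along \<open>(0, snd x)\<close> is \<open>8 * r\<^sup>2 * (1 + u) * (r - (1 + u))\<close>.\<close>

lemma frechet_derivative_defining_function_nonzero:
  assumes "x \<in> rotated_profile"
  shows "frechet_derivative defining_function (at x) \<noteq> (\<lambda>v. 0)"
proof -
  define u r where "u = fst x" and "r = norm (snd x)"
  have region: "x \<in> profile_region" and zero: "(r - (1 + u))\<^sup>2 = 1 + 2 * u"
    using assms defining_function_eq_0_iff[of x] by (auto simp: rotated_profile_eq_zero_set u_def r_def)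
  have ur: "u > - 1 / 2" "r > 1 + u"
    using region by (auto simp: profile_region_def u_def r_def)
  have "(defining_function has_derivative
      (\<lambda>v. 2 * (snd x \<bullet> snd x + (fst x)\<^sup>2) * (2 * (snd x \<bullet> snd v) + 2 * fst x * fst v)
        - 4 * (2 * (snd x \<bullet> snd v) * (1 + fst x)\<^sup>2
          + (snd x \<bullet> snd x) * (2 * (1 + fst x) * fst v)))) (at x)"
    unfolding defining_function_def[abs_def]
    by (auto intro!: derivative_eq_intros ext simp: inner_commute algebra_simps)
  then have "frechet_derivative defining_function (at x) (0, snd x) =
      2 * (r\<^sup>2 + u\<^sup>2) * (2 * r\<^sup>2) - 4 * (2 * r\<^sup>2 * (1 + u)\<^sup>2)"
    by (simp add: frechet_derivative_at[symmetric] u_def r_def power2_norm_eq_inner)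
  also have "\<dots> = 8 * r\<^sup>2 * (1 + u) * (r - (1 + u))"
    using zero by algebra
  also have "\<dots> > 0"
    using ur by (intro mult_pos_pos) auto
  finally show ?thesis
    by (metis less_irrefl)
qed

lemma smooth_hypersurface_rotated_profile: "smooth_hypersurface rotated_profile"
  unfolding smooth_hypersurface_def
  using open_profile_region smooth_on_defining_function rotated_profile_subset_region
    rotated_profile_eq_zero_set frechet_derivative_defining_function_nonzero
  by (intro ballI exI[of _ profile_region] exI[of _ defining_function]) blast

section \<open>Normal vectors\<close>

text \<open>The curve rotates \<open>y\<close> towards \<open>w\<close> inside the sphere \<open>x\<^sup>0 = const\<close>.\<close>

lemma rotation_tangent:
  assumes "(u, y) \<in> rotated_profile" "y \<bullet> w = 0" "norm w = norm y"
  shows "(0, w) \<in> tangent_space rotated_profile (u, y)"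
proof -
  define \<gamma> where "\<gamma> t = (u, 0) + cos t *\<^sub>R (0, y) + sin t *\<^sub>R (0, w)" for t
  have "(norm (cos t *\<^sub>R y + sin t *\<^sub>R w))\<^sup>2 = (norm y)\<^sup>2" for t
  proof -
    have ww: "w \<bullet> w = y \<bullet> y"
      using assms(3) by (simp flip: power2_norm_eq_inner)
    have "(norm (cos t *\<^sub>R y + sin t *\<^sub>R w))\<^sup>2 = ((cos t)\<^sup>2 + (sin t)\<^sup>2) * (y \<bullet> y)"
      using assms(2) ww unfolding power2_norm_eq_inner
      by (simp add: inner_add inner_commute[of w y] power2_eq_square distrib_right
          del: sin_cos_squared_add3)
    then show ?thesis
      by (simp add: power2_norm_eq_inner)
  qed
  then have "norm (cos t *\<^sub>R y + sin t *\<^sub>R w) = norm y" for t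
    by (simp add: power2_eq_iff_nonneg)
  with assms(1) have "\<gamma> t \<in> rotated_profile" for t
    by (simp add: \<gamma>_def rotated_profile_def)
  moreover have "smooth_on {-1<..<1} \<gamma>"
    unfolding \<gamma>_def[abs_def] by (rule smooth_on_elliptic_curve)
  moreover have "\<gamma> 0 = (u, y)"
    by (simp add: \<gamma>_def)
  moreover have "(\<gamma> has_vector_derivative (0, w)) (at 0)"
    unfolding \<gamma>_def[abs_def] by (auto intro!: derivative_eq_intros)
  ultimately show ?thesis
    unfolding tangent_space_def
    by (intro CollectI exI[of _ "1::real"] conjI exI[of _ \<gamma>]) auto
qed

text \<open>The curve moves along the profile, \<open>\<tau> \<mapsto> s + \<tau>\<close>, in the fixed radial direction \<open>e\<close>.\<close>

lemma profile_tangent: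
  assumes "s > 0" "norm e = 1"
  shows "(s, (1 + s) *\<^sub>R e) \<in> tangent_space rotated_profile ((s\<^sup>2 - 1) / 2, ((1 + s)\<^sup>2 / 2) *\<^sub>R e)"
proof -
  define \<gamma> where "\<gamma> \<tau> = ((s\<^sup>2 - 1) / 2, ((1 + s)\<^sup>2 / 2) *\<^sub>R e) + \<tau> *\<^sub>R (s, (1 + s) *\<^sub>R e)
      + \<tau>\<^sup>2 *\<^sub>R (1 / 2, (1 / 2) *\<^sub>R e)" for \<tau>
  have \<gamma>: "\<gamma> \<tau> = (((s + \<tau>)\<^sup>2 - 1) / 2, ((1 + (s + \<tau>))\<^sup>2 / 2) *\<^sub>R e)" for \<tau>
  proof -
    have "(1 + (s + \<tau>))\<^sup>2 / 2 = (1 + s)\<^sup>2 / 2 + \<tau> * (1 + s) + \<tau>\<^sup>2 / 2"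
      "((s + \<tau>)\<^sup>2 - 1) / 2 = (s\<^sup>2 - 1) / 2 + \<tau> * s + \<tau>\<^sup>2 / 2"
      by (simp_all add: power2_eq_square field_simps)
    then show ?thesis
      by (simp only: \<gamma>_def) (simp only: scaleR_Pair add_Pair scaleR_scaleR real_scaleR_def
          scaleR_add_left mult_1_right times_divide_eq_right, simp add: algebra_simps)
  qed
  have "\<gamma> \<tau> \<in> rotated_profile" if "\<tau> \<in> {-s<..<s}" for \<tau>
    using that assms(2) unfolding rotated_profile_def \<gamma>
    by (intro CollectI exI[of _ "s + \<tau>"]) auto
  moreover have "smooth_on {-s<..<s} \<gamma>"
    unfolding \<gamma>_def[abs_def] by (rule smooth_on_quadratic_curve)
  moreover have "\<gamma> 0 = ((s\<^sup>2 - 1) / 2, ((1 + s)\<^sup>2 / 2) *\<^sub>R e)"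
    by (simp add: \<gamma>_def)
  moreover have "(\<gamma> has_vector_derivative (s, (1 + s) *\<^sub>R e)) (at 0)"
    unfolding \<gamma>_def[abs_def] has_vector_derivative_def
    by (auto intro!: derivative_eq_intros simp: algebra_simps)
  ultimately show ?thesis
    unfolding tangent_space_def using assms(1)
    by (intro CollectI exI[of _ s] conjI exI[of _ \<gamma>]) auto
qed

lemma normal_vector_timelike:
  assumes "p \<in> rotated_profile" "normal_vector rotated_profile p \<nu>"
  shows "timelike \<nu>"
proof -
  obtain s where s: "s > 0" "fst p = (s\<^sup>2 - 1) / 2" "norm (snd p) = (1 + s)\<^sup>2 / 2"
    using assms(1) by (auto simp: rotated_profile_def)
  define e where "e = sgn (snd p)"
  have "snd p \<noteq> 0"
    using s by auto
  then have e: "norm e = 1" and sndp: "snd p = ((1 + s)\<^sup>2 / 2) *\<^sub>R e"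
    by (simp_all add: e_def norm_sgn sgn_div_norm flip: s(3))
  have orth: "eta \<nu> v = 0" if "v \<in> tangent_space rotated_profile p" for v
    using assms(2) that by (auto simp: normal_vector_def)
  \<comment> \<open>The component of \<open>snd \<nu>\<close> orthogonal to \<open>e\<close> vanishes: rescaled to the length of \<open>snd p\<close> it
    would be a tangent vector that is not orthogonal to \<open>\<nu>\<close>.\<close>
  define c where "c = snd \<nu> \<bullet> e"
  define z where "z = snd \<nu> - c *\<^sub>R e"
  have ez: "e \<bullet> z = 0"
    using e by (simp add: z_def c_def inner_diff_right inner_commute norm_eq_1)
  have "z = 0"
  proof (rule ccontr)
    assume "z \<noteq> 0"
    define w where "w = (norm (snd p) / norm z) *\<^sub>R z"
    have "(0, w) \<in> tangent_space rotated_profile (fst p, snd p)"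
    proof (rule rotation_tangent)
      show "(fst p, snd p) \<in> rotated_profile"
        using assms(1) by simp
      show "snd p \<bullet> w = 0"
        using ez by (simp add: w_def sndp)
      show "norm w = norm (snd p)"
        using \<open>z \<noteq> 0\<close> by (simp add: w_def)
    qed
    then have "snd \<nu> \<bullet> z = 0"
      using orth[of "(0, w)"] \<open>z \<noteq> 0\<close> \<open>snd p \<noteq> 0\<close> by (simp add: eta_eq_inner w_def)
    then have "z \<bullet> z = 0"
      using ez by (simp add: z_def inner_diff_left)
    with \<open>z \<noteq> 0\<close> show False by simp
  qed
  then have \<nu>: "snd \<nu> = c *\<^sub>R e"
    by (simp add: z_def)
  have "(s, (1 + s) *\<^sub>R e) \<in> tangent_space rotated_profile p"
    using profile_tangent[OF s(1) e] s(2) sndp by (metis prod.collapse)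
  from orth[OF this] have slope: "fst \<nu> * s = c * (1 + s)"
    using e by (simp add: eta_eq_inner \<nu> norm_eq_1 mult.commute)
  have "\<nu> \<noteq> 0"
    using assms(2) by (simp add: normal_vector_def)
  then have "c \<noteq> 0"
    using slope \<nu> s(1) by (auto simp: prod_eq_iff)
  have "eta \<nu> \<nu> * s\<^sup>2 = c\<^sup>2 * s\<^sup>2 - (fst \<nu> * s)\<^sup>2"
    using e by (simp add: eta_eq_inner \<nu> norm_eq_1 power2_eq_square algebra_simps)
  also have "\<dots> = - (c\<^sup>2 * (1 + 2 * s))"
    unfolding slope by (simp add: power2_eq_square algebra_simps)
  also have "\<dots> < 0"
    using \<open>c \<noteq> 0\<close> s(1) by simp
  finally show ?thesis
    by (auto simp: timelike_def mult_less_0_iff)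
qed

theorem proposition3p13:
  fixes n :: nat
  assumes "n \<ge> 1" and "CARD('k::finite) = n + 1"
  shows "\<exists>\<alpha>\<in>Psi. spacelike_hypersurface (dS (range (h_of \<alpha>)) (f_of \<alpha>) :: 'k minkowski set)"
proof (rule bexI[OF _ witness_in_Psi])
  show "spacelike_hypersurface (dS (range (h_of witness)) (f_of witness) :: 'k minkowski set)"
    unfolding dS_witness spacelike_hypersurface_def
    using smooth_hypersurface_rotated_profile normal_vector_timelike by blast
qed

end
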